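(* Let $m \le n$, let $b \in \mathbb{R}^m$, and let $\Omega : \mathbb{R}^n \to [0,\infty)$ be a seminorm whose unit ball $\{x \in \mathbb{R}^n \mid \Omega(x) \le 1\}$ is a polyhedron. Define the set-valued map $S : \mathbb{R}^{m \times n} \to 2^{\mathbb{R}^n}$ by $$S(A) = \operatorname*{argmin}_{x \in \mathbb{R}^n,\ A x = b} \Omega(x).$$ Then for every full-rank matrix $A_0 \in \mathbb{R}^{m \times n}$ such that $\min_{A_0 x = b} \Omega(x) > 0$, and for every $x_0 \in S(A_0)$, the map $S$ is calm at $(A_0, x_0)$.
   Context: Polyhedron means convex polyhedron, i.e. the intersection of finitely many (closed) half-spaces of $\mathbb{R}^n$; it need not be bounded. $\mathbb{R}^n$ carries the Euclidean norm and $\mathbb{R}^{m\times n}$ carries the spectral norm; both are denoted $\|\cdot\|$. For a point $x$ and a set $C \subseteq \mathbb{R}^n$, $d(x,C)$ denotes the distance from $x$ to $C$ induced by the Euclidean norm. The set $S(A)$ consists of all $x$ with $Ax=b$ such that $\Omega(x) \le \Omega(z)$ for every $z$ with $Az=b$ (it may contain more than one point, and it is empty if $Ax=b$ has no solution). Calmness: let $X, Y$ be Banach spaces. A map $F : Y \to 2^X$ is calm at $(y_0, x_0) \in \mathrm{Graph}(F)$ (that is, $x_0 \in F(y_0)$) if there exist neighborhoods $U$ of $y_0$ and $V$ of $x_0$ and a constant $L = L(y_0,x_0)$ such that for all $y_1 \in U$ and all $x_1 \in F(y_1) \cap V$, $$d(x_1, F(y_0)) \le L \, \|y_0 - y_1\|.$$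 Here it is applied with $Y = \mathbb{R}^{m\times n}$ and $X = \mathbb{R}^n$. *)

theory Defs
  imports "HOL-Analysis.Analysis"
begin

definition seminorm :: "('a::real_vector \<Rightarrow> real) \<Rightarrow> bool" where
  "seminorm p \<longleftrightarrow>
     (\<forall>x. 0 \<le> p x) \<and>
     (\<forall>c x. p (c *\<^sub>R x) = \<bar>c\<bar> * p x) \<and>
     (\<forall>x y. p (x + y) \<le> p x + p y)"

text \<open>The type class norm on \<^typ>\<open>real^'n^'m\<close> is the Frobenius norm, so the spectral norm
  is introduced separately.\<close>

definition spectral_norm :: "real^'n^'m \<Rightarrow> real" where
  "spectral_norm A = onorm (\<lambda>x. A *v x)"

text \<open>Calmness of a set-valued map at a point of its graph. The norm \<open>N\<close> of the parameter space is
  an argument because it need not be the type class norm (see above); accordingly a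
  neighbourhood of \<open>y0\<close> is a set that contains an open \<open>N\<close>-ball around \<open>y0\<close>.
  Since \<open>x0 \<in> F y0\<close>, the set \<open>F y0\<close> is nonempty and \<^const>\<open>infdist\<close> is the genuine distance.\<close>

definition calm_at ::
    "('y::real_vector \<Rightarrow> real) \<Rightarrow> ('y \<Rightarrow> 'x::banach set) \<Rightarrow> 'y \<Rightarrow> 'x \<Rightarrow> bool" where
  "calm_at N F y0 x0 \<longleftrightarrow>
     x0 \<in> F y0 \<and>
     (\<exists>U V L.
        (\<exists>r>0. {y. N (y - y0) < r} \<subseteq> U) \<and>
        (\<exists>r>0. ball x0 r \<subseteq> V) \<and>
        (\<forall>y1\<in>U. \<forall>x1\<in>F y1 \<inter> V. infdist x1 (F y0) \<le> L * N (y0 - y1)))"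

definition argmin_map ::
    "(real^'n \<Rightarrow> real) \<Rightarrow> real^'m \<Rightarrow> real^'n^'m \<Rightarrow> (real^'n) set" where
  "argmin_map \<Omega> b A = {x. A *v x = b \<and> (\<forall>z. A *v z = b \<longrightarrow> \<Omega> x \<le> \<Omega> z)}"

text \<open>Whenever \<^term>\<open>argmin_map \<Omega> b A\<close> is nonempty, this infimum is attained, i.e. it is the
  minimum of \<open>\<Omega>\<close> subject to \<open>A x = b\<close>.\<close>

definition min_value :: "(real^'n \<Rightarrow> real) \<Rightarrow> real^'m \<Rightarrow> real^'n^'m \<Rightarrow> real" where
  "min_value \<Omega> b A = (INF x\<in>{x. A *v x = b}. \<Omega> x)"

end

theory Submission
  imports Defs
begin

text \<open>\<open>S(A0)\<close> is the polyhedron \<open>{x. A0 x = b, \<Omega> x \<le> v0}\<close>, where \<open>v0 > 0\<close> is the minimum, so Hoffman's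
  error bound estimates the distance of a nearby solution \<open>x1 \<in> S(A)\<close> to it by the two residuals
  \<open>A0 x1 - b = (A0 - A) x1\<close> and \<open>(\<Omega> x1 - v0)\<^sup>+\<close>. The second one is linear in \<open>\<parallel>A - A0\<parallel>\<close>, because a right
  inverse \<open>B\<close> of \<open>A0\<close> makes \<open>A B\<close> invertible with a uniformly bounded inverse, and hence \<open>x0\<close> can be
  corrected to a feasible point for \<open>A\<close> at distance \<open>O(\<parallel>A - A0\<parallel>)\<close>.\<close>

subsection \<open>Hoffman's error bound\<close>

text \<open>The hypothesis on \<open>u\<close> says that \<open>u\<close> is in the polar of the cone cut out by the \<open>a i\<close>. Such a
  \<open>u \<noteq> 0\<close> cannot be in the cone itself, so the right-hand side is positive on the compact set of
  unit vectors of the polar.\<close>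

lemma polar_cone_bound:
  fixes a :: "'i \<Rightarrow> 'a::euclidean_space"
  assumes "finite J"
  obtains c where "c > 0"
    "\<And>u. (\<And>d. (\<And>i. i \<in> J \<Longrightarrow> a i \<bullet> d \<le> 0) \<Longrightarrow> u \<bullet> d \<le> 0) \<Longrightarrow>
       c * norm u \<le> (\<Sum>i\<in>J. max 0 (a i \<bullet> u))"
proof -
  define K where "K = {d. \<forall>i\<in>J. a i \<bullet> d \<le> 0}"
  define N where "N = (\<Inter>d\<in>K. {u. d \<bullet> u \<le> 0}) \<inter> sphere 0 1"
  define g where "g = (\<lambda>u. \<Sum>i\<in>J. max 0 (a i \<bullet> u))"
  have cpt: "compact N"
    unfolding N_def by (intro closed_Int_compact closed_INT ballI closed_halfspace_le) auto
  have cont: "continuous_on N g"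
    unfolding g_def by (intro continuous_intros)
  have pos: "g u > 0" if "u \<in> N" for u
  proof -
    have "u \<notin> K"
      using that unfolding N_def by (auto simp: dot_square_norm)
    then obtain i where "i \<in> J" "a i \<bullet> u > 0"
      unfolding K_def by (auto simp: not_le)
    then show ?thesis
      unfolding g_def using assms by (intro sum_pos2[where i = i]) auto
  qed
  obtain c where c: "c > 0" "\<And>u. u \<in> N \<Longrightarrow> c \<le> g u"
  proof (cases "N = {}")
    case True
    then show ?thesis using that[of 1] by auto
  next
    case False
    then show ?thesis
      using continuous_attains_inf[OF cpt _ cont] pos that by metis
  qed
  have "c * norm u \<le> g u" if u: "\<And>d. (\<And>i. i \<in> J \<Longrightarrow> a i \<bullet> d \<le> 0) \<Longrightarrow> u \<bullet> d \<le> 0" for u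
  proof (cases "u = 0")
    case True
    then show ?thesis by (simp add: g_def)
  next
    case False
    \<comment> \<open>The polar is a cone and \<open>g\<close> is positively homogeneous, so the
      bound on unit vectors rescales to \<open>u\<close>.\<close>
    have "u /\<^sub>R norm u \<in> N"
      using False u by (auto simp: N_def K_def inner_commute[of _ u] mult_le_0_iff)
    then have "c \<le> g (u /\<^sub>R norm u)" by (rule c)
    also have "g (u /\<^sub>R norm u) = (\<Sum>i\<in>J. max 0 (a i \<bullet> u) / norm u)"
      unfolding g_def using False by (intro sum.cong) (auto simp: max_def field_simps)
    also have "\<dots> = g u / norm u"
      by (simp add: g_def sum_divide_distrib)
    finally show ?thesis using False by (simp add: field_simps)
  qed
  then show ?thesis using that c(1) unfolding g_def by blast
qed

text \<open>If \<open>p\<close> is the closest point to \<open>x\<close>, then \<open>x - p\<close>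
  is in the polar of the cone cut out by the constraints active at \<open>p\<close>, so
  \<open>polar_cone_bound\<close> controls its norm by these constraints alone. Only finitely many
  active sets can occur, which makes the constant uniform in \<open>x\<close>.\<close>

lemma hoffman_bound:
  fixes a :: "'i \<Rightarrow> 'a::euclidean_space" and \<beta> :: "'i \<Rightarrow> real"
  assumes fin: "finite I" and ne: "{x. \<forall>i\<in>I. a i \<bullet> x \<le> \<beta> i} \<noteq> {}"
  obtains L where "L \<ge> 0"
    "\<And>x r. \<lbrakk>r \<ge> 0; \<And>i. i \<in> I \<Longrightarrow> a i \<bullet> x \<le> \<beta> i + r\<rbrakk> \<Longrightarrow>
       infdist x {x. \<forall>i\<in>I. a i \<bullet> x \<le> \<beta> i} \<le> L * r"
proof -
  define P where "P = {x. \<forall>i\<in>I. a i \<bullet> x \<le> \<beta> i}"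
  have P_alt: "P = (\<Inter>i\<in>I. {x. a i \<bullet> x \<le> \<beta> i})"
    by (auto simp: P_def)
  have clP: "closed P"
    unfolding P_alt by (intro closed_INT ballI closed_halfspace_le)
  have cvP: "convex P"
    unfolding P_alt by (intro convex_INT convex_halfspace_le)
  have neP: "P \<noteq> {}" using ne by (simp add: P_def)
  have "\<forall>J\<in>Pow I. \<exists>c>0. \<forall>u. (\<forall>d. (\<forall>i\<in>J. a i \<bullet> d \<le> 0) \<longrightarrow> u \<bullet> d \<le> 0) \<longrightarrow>
       c * norm u \<le> (\<Sum>i\<in>J. max 0 (a i \<bullet> u))"
  proof
    fix J assume "J \<in> Pow I"
    then have "finite J" using fin finite_subset by auto
    then show "\<exists>c>0. \<forall>u. (\<forall>d. (\<forall>i\<in>J. a i \<bullet> d \<le> 0) \<longrightarrow> u \<bullet> d \<le> 0) \<longrightarrow>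
       c * norm u \<le> (\<Sum>i\<in>J. max 0 (a i \<bullet> u))"
      by (rule polar_cone_bound[of J a]) blast
  qed
  then obtain c where c: "\<And>J. J \<subseteq> I \<Longrightarrow> c J > 0"
    "\<And>J u. \<lbrakk>J \<subseteq> I; \<forall>d. (\<forall>i\<in>J. a i \<bullet> d \<le> 0) \<longrightarrow> u \<bullet> d \<le> 0\<rbrakk> \<Longrightarrow>
       c J * norm u \<le> (\<Sum>i\<in>J. max 0 (a i \<bullet> u))"
    unfolding bchoice_iff by (metis PowI)
  \<comment> \<open>The active set depends on \<open>x\<close>; as all summands are nonnegative, the
    sum over all subsets dominates whichever one occurs.\<close>
  define L where "L = (\<Sum>J\<in>Pow I. real (card J) / c J)"
  have summand: "real (card J) / c J \<ge> 0" if "J \<subseteq> I" for J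
    using c(1)[OF that] by simp
  have "infdist x P \<le> L * r"
    if r: "r \<ge> 0" "\<And>i. i \<in> I \<Longrightarrow> a i \<bullet> x \<le> \<beta> i + r" for x r
  proof -
    define p where "p = closest_point P x"
    have pP: "p \<in> P"
      unfolding p_def by (rule closest_point_in_set[OF clP neP])
    define J where "J = {i\<in>I. a i \<bullet> p = \<beta> i}"
    have JI: "J \<subseteq> I" by (auto simp: J_def)
    \<comment> \<open>A short step from \<open>p\<close> along \<open>d\<close> stays in
      \<open>P\<close>, because the inactive constraints have slack. The variational inequality of
      the projection then gives the sign.\<close>
    have normal: "(x - p) \<bullet> d \<le> 0" if d: "\<forall>i\<in>J. a i \<bullet> d \<le> 0" for d
    proof -
      have "\<forall>\<^sub>F e in at_right (0::real). a i \<bullet> (p + e *\<^sub>R d) \<le> \<beta> i" if i: "i \<in> I" for i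
      proof (cases "i \<in> J")
        case True
        then show ?thesis
          using d by (intro eventually_at_rightI[of 0 1])
            (auto simp: J_def inner_add_right mult_nonneg_nonpos)
      next
        case False
        then have "a i \<bullet> p < \<beta> i"
          using i pP by (force simp: J_def P_def)
        moreover have "((\<lambda>e. a i \<bullet> (p + e *\<^sub>R d)) \<longlongrightarrow> a i \<bullet> (p + 0 *\<^sub>R d)) (at_right 0)"
          by (intro tendsto_intros)
        ultimately have "\<forall>\<^sub>F e in at_right 0. a i \<bullet> (p + e *\<^sub>R d) < \<beta> i"
          by (intro order_tendstoD) auto
        then show ?thesis by (rule eventually_mono) auto
      qed
      then have "\<forall>\<^sub>F e in at_right (0::real). p + e *\<^sub>R d \<in> P"
        unfolding P_def using fin by (simp add: eventually_ball_finite)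
      moreover have "\<forall>\<^sub>F e in at_right (0::real). e > 0"
        by (rule eventually_at_right_less)
      ultimately have "\<forall>\<^sub>F e in at_right (0::real). p + e *\<^sub>R d \<in> P \<and> e > 0"
        by (rule eventually_conj)
      then obtain e where e: "p + e *\<^sub>R d \<in> P" "e > 0"
        using eventually_happens' trivial_limit_at_right_real by blast
      have "(x - p) \<bullet> (p + e *\<^sub>R d - p) \<le> 0"
        unfolding p_def by (rule closest_point_dot[OF cvP clP e(1)[unfolded p_def]])
      then show ?thesis using e(2) by (simp add: mult_le_0_iff)
    qed
    have "c J * norm (x - p) \<le> (\<Sum>i\<in>J. max 0 (a i \<bullet> (x - p)))"
      using c(2)[OF JI] normal by blast
    \<comment> \<open>Active constraints are equalities at \<open>p\<close>, so
      \<open>a i \<bullet> (x - p)\<close> is \<open>a i \<bullet> x - \<beta> i\<close>.\<close>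
    also have "\<dots> \<le> (\<Sum>i\<in>J. r)"
    proof (rule sum_mono)
      fix i assume "i \<in> J"
      then show "max 0 (a i \<bullet> (x - p)) \<le> r"
        using r(1) r(2)[of i] by (auto simp: J_def inner_diff_right)
    qed
    finally have "norm (x - p) \<le> real (card J) / c J * r"
      using c(1)[OF JI] by (simp add: field_simps)
    also have "\<dots> \<le> L * r"
      unfolding L_def using fin JI summand r(1)
      by (intro mult_right_mono member_le_sum) auto
    finally show ?thesis
      using infdist_le[OF pP, of x] by (simp add: dist_norm)
  qed
  moreover have "L \<ge> 0"
    unfolding L_def using summand by (intro sum_nonneg) auto
  ultimately show ?thesis using that unfolding P_def by blast
qed

subsection \<open>Seminorms and spectral norms\<close>

text \<open>Follows from subadditivity along the expansion in the standard basis. It turns a small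
  correction of a point into a small change of \<open>p\<close>.\<close>

lemma seminorm_bounded:
  fixes p :: "'a::euclidean_space \<Rightarrow> real"
  assumes "seminorm p"
  obtains K where "K \<ge> 0" "\<And>x. p x \<le> K * norm x"
proof
  have nonneg: "0 \<le> p x" and scale: "p (t *\<^sub>R x) = \<bar>t\<bar> * p x"
    and triangle: "p (x + y) \<le> p x + p y" for t x y
    using assms by (auto simp: seminorm_def)
  show "(\<Sum>e\<in>Basis. p e) \<ge> 0"
    by (intro sum_nonneg nonneg)
  show "p x \<le> (\<Sum>e\<in>Basis. p e) * norm x" for x
  proof -
    have p0: "p 0 = 0" using scale[of 0 0] by simp
    have "p (\<Sum>e\<in>B. (x \<bullet> e) *\<^sub>R e) \<le> (\<Sum>e\<in>B. \<bar>x \<bullet> e\<bar> * p e)" if "finite B" for B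
      using that
    proof (induction B)
      case (insert e B)
      then show ?case
        using triangle[of "(x \<bullet> e) *\<^sub>R e" "\<Sum>e\<in>B. (x \<bullet> e) *\<^sub>R e"] by (simp add: scale)
    qed (simp add: p0)
    from this[OF finite_Basis] have "p x \<le> (\<Sum>e\<in>Basis. \<bar>x \<bullet> e\<bar> * p e)"
      by (simp add: euclidean_representation)
    also have "\<dots> \<le> (\<Sum>e\<in>Basis. p e * norm x)"
      by (intro sum_mono, subst mult.commute) (intro mult_left_mono nonneg Basis_le_norm)
    finally show ?thesis by (simp add: sum_distrib_right)
  qed
qed

text \<open>Homogeneity carries the half-spaces of the unit ball over to every positive radius
  \<open>t\<close>, with the same normals. The offsets are nonnegative because 0 lies in the unit
  ball.\<close>

lemma polyhedral_seminorm_halfspaces: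
  fixes p :: "'a::euclidean_space \<Rightarrow> real"
  assumes p: "seminorm p" and poly: "polyhedron {x. p x \<le> 1}"
  obtains H where "finite H" "\<And>q. q \<in> H \<Longrightarrow> snd q \<ge> 0"
    "\<And>x t. t > 0 \<Longrightarrow> p x \<le> t \<longleftrightarrow> (\<forall>q\<in>H. fst q \<bullet> x \<le> t * snd q)"
proof -
  have scale: "p (t *\<^sub>R x) = \<bar>t\<bar> * p x" for t x
    using p by (simp add: seminorm_def)
  obtain F where F: "finite F" "{x. p x \<le> 1} = \<Inter> F"
      "\<forall>h\<in>F. \<exists>a b. a \<noteq> 0 \<and> h = {x. a \<bullet> x \<le> b}"
    using poly unfolding polyhedron_def by blast
  then obtain a b where ab: "\<And>h. h \<in> F \<Longrightarrow> h = {x. a h \<bullet> x \<le> b h}"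
    by metis
  define H where "H = (\<lambda>h. (a h, b h)) ` F"
  have ball: "p x \<le> 1 \<longleftrightarrow> (\<forall>q\<in>H. fst q \<bullet> x \<le> snd q)" for x
  proof -
    have "p x \<le> 1 \<longleftrightarrow> (\<forall>h\<in>F. x \<in> h)" using F(2) by blast
    also have "\<dots> \<longleftrightarrow> (\<forall>h\<in>F. a h \<bullet> x \<le> b h)" using ab by blast
    finally show ?thesis by (simp add: H_def)
  qed
  show ?thesis
  proof
    show "finite H" using F(1) by (simp add: H_def)
    have "p 0 = 0" using scale[of 0 0] by simp
    then show "snd q \<ge> 0" if "q \<in> H" for q
      using ball[of 0] that by auto
    show "p x \<le> t \<longleftrightarrow> (\<forall>q\<in>H. fst q \<bullet> x \<le> t * snd q)" if "t > 0" for x t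
      using ball[of "x /\<^sub>R t"] that by (simp add: scale field_simps)
  qed
qed

lemma norm_matrix_vector_mult_le:
  "norm (A *v x) \<le> spectral_norm A * norm x"
  unfolding spectral_norm_def by (rule onorm[OF matrix_vector_mul_bounded_linear])

lemma spectral_norm_nonneg: "0 \<le> spectral_norm A"
  unfolding spectral_norm_def by (rule onorm_pos_le[OF matrix_vector_mul_bounded_linear])

lemma spectral_norm_minus_commute: "spectral_norm (A - B) = spectral_norm (B - A)"
proof -
  have "(\<lambda>x. (A - B) *v x) = (\<lambda>x. - ((B - A) *v x))"
    by (simp add: algebra_simps)
  then show ?thesis by (simp add: spectral_norm_def onorm_neg)
qed

text \<open>\<open>A ** B\<close> differs from the identity by \<open>(A - A0) ** B\<close>, of
  spectral norm at most 1/2. Hence it shrinks no vector by more than a factor 2, so it is injective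
  and, being square, surjective.\<close>

lemma perturbed_right_inverse:
  fixes A A0 :: "real^'n^'m" and B :: "real^'m^'n"
  assumes B: "A0 ** B = mat 1" and small: "spectral_norm (A - A0) * spectral_norm B \<le> 1/2"
  obtains y where "A *v (B *v y) = r" "norm y \<le> 2 * norm r"
proof -
  have lower: "norm y \<le> 2 * norm (A *v (B *v y))" for y
  proof -
    have "A *v (B *v y) = y + (A - A0) *v (B *v y)"
    proof -
      have "A0 *v (B *v y) = y"
        using B by (simp add: matrix_vector_mul_assoc)
      then show ?thesis by (simp add: matrix_vector_mult_diff_rdistrib)
    qed
    moreover have "norm ((A - A0) *v (B *v y)) \<le> 1/2 * norm y"
    proof -
      have "norm ((A - A0) *v (B *v y)) \<le> spectral_norm (A - A0) * (spectral_norm B * norm y)"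
        by (meson norm_matrix_vector_mult_le spectral_norm_nonneg mult_left_mono order_trans)
      also have "\<dots> \<le> 1/2 * norm y"
        using mult_right_mono[OF small, of "norm y"] by (simp add: mult.assoc)
      finally show ?thesis .
    qed
    ultimately show ?thesis
      using norm_diff_ineq[of y "(A - A0) *v (B *v y)"] by simp
  qed
  have lin: "linear ((*v) (A ** B))" by simp
  have "inj ((*v) (A ** B))"
    unfolding linear_injective_0[OF lin]
    using lower by (metis matrix_vector_mul_assoc mult_zero_right norm_le_zero_iff norm_zero)
  then have "surj ((*v) (A ** B))"
    by (rule linear_inj_imp_surj[OF lin])
  then obtain y where "A *v (B *v y) = r"
    by (metis matrix_vector_mul_assoc surjD)
  with lower[of y] that show ?thesis by metis
qed

subsection \<open>Calmness\<close>

text \<open>Minimality of \<open>x\<close> for \<open>A\<close> allows comparison with any feasible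
  point; the one used is \<open>x0 + B *v y\<close>, where the correction cancels the residual
  \<open>b - A *v x0\<close>.\<close>

lemma argmin_value_perturbation:
  fixes A0 :: "real^'n^'m"
  assumes p: "seminorm p" and surj: "surj ((*v) A0)" and x0: "A0 *v x0 = b"
  obtains \<rho> C where "\<rho> > 0" "C \<ge> 0"
    "\<And>A x. \<lbrakk>spectral_norm (A - A0) < \<rho>; x \<in> argmin_map p b A\<rbrakk> \<Longrightarrow>
       p x \<le> p x0 + C * spectral_norm (A - A0)"
proof -
  obtain B :: "real^'m^'n" where B: "A0 ** B = mat 1"
    using surj matrix_right_invertible_surjective by blast
  obtain K where K: "K \<ge> 0" "\<And>x. p x \<le> K * norm x"
    using seminorm_bounded[OF p] by blast
  define \<nu> where "\<nu> = spectral_norm B"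
  have \<nu>: "\<nu> \<ge> 0" by (simp add: \<nu>_def spectral_norm_nonneg)
  show ?thesis
  proof
    \<comment> \<open>This radius yields the smallness that \<open>perturbed_right_inverse\<close>
      requires; the added 1 keeps the denominator positive when \<open>\<nu>\<close> is only known
      to be nonnegative.\<close>
    show "1 / (2 * (\<nu> + 1)) > 0" using \<nu> by simp
    show "K * (\<nu> * (2 * norm x0)) \<ge> 0" using \<nu> K(1) by simp
  next
    fix A x
    assume small: "spectral_norm (A - A0) < 1 / (2 * (\<nu> + 1))" and x: "x \<in> argmin_map p b A"
    define \<delta> where "\<delta> = spectral_norm (A - A0)"
    have \<delta>: "\<delta> \<ge> 0" by (simp add: \<delta>_def spectral_norm_nonneg)
    have "\<delta> * (\<nu> + 1) < 1/2"
      using small \<nu> by (simp add: \<delta>_def field_simps)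
    then have "spectral_norm (A - A0) * spectral_norm B \<le> 1/2"
      using \<delta> by (simp add: \<delta>_def \<nu>_def algebra_simps)
    then obtain y where y: "A *v (B *v y) = b - A *v x0" "norm y \<le> 2 * norm (b - A *v x0)"
      by (rule perturbed_right_inverse[OF B])
    have "b - A *v x0 = (A0 - A) *v x0"
      using x0 by (simp add: matrix_vector_mult_diff_rdistrib)
    then have "norm (b - A *v x0) \<le> \<delta> * norm x0"
      by (metis norm_matrix_vector_mult_le spectral_norm_minus_commute \<delta>_def)
    with y(2) have ny: "norm y \<le> 2 * norm x0 * \<delta>" by (simp add: mult_ac)
    have "A *v (x0 + B *v y) = b"
      using y(1) by (simp add: matrix_vector_right_distrib)
    then have "p x \<le> p (x0 + B *v y)"
      using x by (auto simp: argmin_map_def)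
    also have "\<dots> \<le> p x0 + p (B *v y)"
      using p by (auto simp: seminorm_def)
    also have "p (B *v y) \<le> K * norm (B *v y)" by (rule K)
    also have "\<dots> \<le> K * (\<nu> * norm y)"
      using K(1) by (simp add: \<nu>_def mult_left_mono norm_matrix_vector_mult_le)
    also have "\<dots> \<le> K * (\<nu> * (2 * norm x0 * \<delta>))"
      using K(1) \<nu> ny by (intro mult_left_mono)
    finally show "p x \<le> p x0 + K * (\<nu> * (2 * norm x0)) * spectral_norm (A - A0)"
      by (simp add: \<delta>_def mult_ac)
  qed
qed

theorem theorem3p1:
  fixes \<Omega> :: "real^'n \<Rightarrow> real"
    and b :: "real^'m"
    and A0 :: "real^'n^'m"
    and x0 :: "real^'n"
  assumes "CARD('m) \<le> CARD('n)"
    and "seminorm \<Omega>"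
    and "polyhedron {x. \<Omega> x \<le> 1}"
    and "rank A0 = min CARD('m) CARD('n)"
    and "min_value \<Omega> b A0 > 0"
    and "x0 \<in> argmin_map \<Omega> b A0"
  shows "calm_at spectral_norm (argmin_map \<Omega> b) A0 x0"
proof -
  define v0 where "v0 = \<Omega> x0"
  have A0x0: "A0 *v x0 = b" and x0_min: "\<And>z. A0 *v z = b \<Longrightarrow> v0 \<le> \<Omega> z"
    using assms(6) by (auto simp: argmin_map_def v0_def)
  have "min_value \<Omega> b A0 \<le> v0"
    unfolding min_value_def v0_def
    by (rule cINF_lower) (use A0x0 assms(2) in \<open>auto simp: seminorm_def intro!: bdd_belowI2[where m = 0]\<close>)
  \<comment> \<open>Positivity makes the half-space description of seminorm balls available at
    radius \<open>v0\<close>.\<close>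
  with assms(5) have v0: "v0 > 0" by simp
  have "surj ((*v) A0)"
    using assms(1,4) full_rank_surjective[of A0] by simp
  from argmin_value_perturbation[OF assms(2) this A0x0]
  obtain \<rho> C where \<rho>: "\<rho> > 0" and C: "C \<ge> 0"
    and value_le: "\<And>A x. \<lbrakk>spectral_norm (A - A0) < \<rho>; x \<in> argmin_map \<Omega> b A\<rbrakk> \<Longrightarrow>
       \<Omega> x \<le> v0 + C * spectral_norm (A - A0)"
    unfolding v0_def by blast
  obtain H where H: "finite H" "\<And>q. q \<in> H \<Longrightarrow> snd q \<ge> 0"
    "\<And>x t. t > 0 \<Longrightarrow> \<Omega> x \<le> t \<longleftrightarrow> (\<forall>q\<in>H. fst q \<bullet> x \<le> t * snd q)"
    using polyhedral_seminorm_halfspaces[OF assms(2,3)] by blast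
  \<comment> \<open>Each pair holds the normal and offset of one inequality; every row of
    \<open>A0 x = b\<close> enters as two opposite inequalities.\<close>
  define I where "I = (\<lambda>q. (fst q, v0 * snd q)) ` H \<union> range (\<lambda>i. (row i A0, b $ i))
    \<union> range (\<lambda>i. (- row i A0, - b $ i))"
  have row: "row i A0 \<bullet> x = (A0 *v x) $ i" for i x
    by (simp add: matrix_vector_mul_component row_def)
  have S_eq: "argmin_map \<Omega> b A0 = {x. \<forall>i\<in>I. fst i \<bullet> x \<le> snd i}"
  proof -
    have "argmin_map \<Omega> b A0 = {x. A0 *v x = b \<and> \<Omega> x \<le> v0}"
      using x0_min A0x0 by (force simp: argmin_map_def v0_def)
    also have "\<dots> = {x. \<forall>i\<in>I. fst i \<bullet> x \<le> snd i}"
      unfolding I_def by (auto simp: H(3)[OF v0] ball_Un row vec_eq_iff intro: antisym)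
    finally show ?thesis .
  qed
  have finI: "finite I" using H(1) by (simp add: I_def)
  have neI: "{x. \<forall>i\<in>I. fst i \<bullet> x \<le> snd i} \<noteq> {}"
    using assms(6) S_eq by blast
  obtain L where L: "\<And>x r. \<lbrakk>r \<ge> 0; \<And>i. i \<in> I \<Longrightarrow> fst i \<bullet> x \<le> snd i + r\<rbrakk> \<Longrightarrow>
       infdist x (argmin_map \<Omega> b A0) \<le> L * r"
    using hoffman_bound[OF finI neI] unfolding S_eq by blast
  define M where "M = (\<Sum>q\<in>H. snd q)"
  have M: "M \<ge> 0" and M_ge: "\<And>q. q \<in> H \<Longrightarrow> snd q \<le> M"
    unfolding M_def using H(1,2) by (auto intro: sum_nonneg member_le_sum)
  \<comment> \<open>Chosen so that \<open>k * \<delta>\<close> bounds every violation: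
    \<open>norm x0 + 1\<close> bounds \<open>norm x\<close> and serves the equations,
    \<open>C * M\<close> serves the facets.\<close>
  define k where "k = norm x0 + 1 + C * M"
  have "infdist x (argmin_map \<Omega> b A0) \<le> L * k * spectral_norm (A0 - A)"
    if A: "spectral_norm (A - A0) < \<rho>" and x: "x \<in> argmin_map \<Omega> b A" "x \<in> ball x0 1" for A x
  proof -
    define \<delta> where "\<delta> = spectral_norm (A - A0)"
    have \<delta>: "\<delta> \<ge> 0" by (simp add: \<delta>_def spectral_norm_nonneg)
    have norm_x: "norm x \<le> norm x0 + 1"
      using x(2) norm_triangle_sub[of x x0] by (simp add: dist_norm norm_minus_commute)
    have "fst i \<bullet> x \<le> snd i + k * \<delta>" if "i \<in> I" for i
    proof -
      have "A0 *v x - b = (A0 - A) *v x"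
        using x(1) by (simp add: argmin_map_def matrix_vector_mult_diff_rdistrib)
      then have "norm (A0 *v x - b) \<le> \<delta> * norm x"
        by (metis norm_matrix_vector_mult_le spectral_norm_minus_commute \<delta>_def)
      also have "\<dots> \<le> \<delta> * k"
        using \<delta> norm_x C M by (intro mult_left_mono) (auto simp: k_def add_increasing2)
      finally have residual: "\<bar>(A0 *v x) $ j - b $ j\<bar> \<le> k * \<delta>" for j
        using norm_bound_component_le_cart[of "A0 *v x - b" "\<delta> * k" j] by (simp add: mult.commute)
      \<comment> \<open>\<open>x\<close> lies in the seminorm ball of radius
        \<open>v0 + C * \<delta>\<close>, whose offsets exceed those at radius \<open>v0\<close> by
        \<open>C * \<delta> * snd q\<close>.\<close>
      have facet: "fst q \<bullet> x \<le> v0 * snd q + k * \<delta>" if q: "q \<in> H" for q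
      proof -
        have "v0 + C * \<delta> > 0" using v0 C \<delta> by (simp add: add_pos_nonneg)
        moreover have "\<Omega> x \<le> v0 + C * \<delta>"
          using value_le[OF A x(1)] by (simp add: \<delta>_def)
        ultimately have "fst q \<bullet> x \<le> (v0 + C * \<delta>) * snd q"
          using H(3) q by blast
        also have "\<dots> = v0 * snd q + (C * snd q) * \<delta>"
          by (simp add: algebra_simps)
        also have "(C * snd q) * \<delta> \<le> k * \<delta>"
        proof (rule mult_right_mono[OF _ \<delta>])
          have "C * snd q \<le> C * M" using C M_ge[OF q] by (rule mult_left_mono[rotated])
          then show "C * snd q \<le> k" by (simp add: k_def add_increasing)
        qed
        finally show ?thesis by simp
      qed
      have lower: "b $ j - k * \<delta> \<le> (A0 *v x) $ j" and upper: "(A0 *v x) $ j \<le> b $ j + k * \<delta>" for j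
        using residual[of j] by linarith+
      show ?thesis
        using that facet lower upper unfolding I_def
        by (auto simp: row algebra_simps)
    qed
    moreover have "k * \<delta> \<ge> 0" using \<delta> C M by (simp add: k_def)
    ultimately have "infdist x (argmin_map \<Omega> b A0) \<le> L * (k * \<delta>)"
      by (intro L)
    then show ?thesis
      by (simp add: \<delta>_def mult.assoc spectral_norm_minus_commute[of A])
  qed
  \<comment> \<open>The neighbourhoods are the spectral \<open>\<rho>\<close>-ball around
    \<open>A0\<close> and the unit ball around \<open>x0\<close>; the calmness constant is
    \<open>L * k\<close>.\<close>
  then have "\<forall>A\<in>{A. spectral_norm (A - A0) < \<rho>}. \<forall>x\<in>argmin_map \<Omega> b A \<inter> ball x0 1.
      infdist x (argmin_map \<Omega> b A0) \<le> L * k * spectral_norm (A0 - A)"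
    by blast
  then show ?thesis
    unfolding calm_at_def using assms(6) \<rho> zero_less_one subset_refl by meson
qed

end
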